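(* Let $k\ge1$ be an integer. For every $n\ge0$, \[\sum_F u^{\mathrm{prop}\,F}=P_n\bigl(k,(k+1)u,u\bigr),\] where the sum is over all $k$-colored ordered forests $F$ on the vertex set $[n]$, and for $n\ge1$, \[\sum_T u^{\mathrm{prop}\,T}=-P_n\bigl(k,(k+1)u,-u\bigr),\] where the sum is over all $k$-colored ordered trees $T$ on the vertex set $[n]$.
   Context: An ordered tree is a rooted tree in which the children of each vertex are linearly ordered; an ordered forest is a forest of ordered trees in which the trees are also linearly ordered. A $k$-colored ordered forest is an ordered forest whose edges are colored with colors $1,\dots,k$ such that among the children of any vertex, those joined by an edge of color $1$ come first, then those of color $2$, and so on (not every color need appear). A $k$-colored ordered tree is a $k$-colored ordered forest with one tree. A vertex is proper if its label is less than the labels of all its proper descendants (vertices $w\neq v$ such that $v$ lies on the path from the root to $w$); $\mathrm{prop}$ is the number of proper vertices. $P_n(a,b,c)=c\prod_{i=1}^{n-1}(ia+(n-i)b+c)$ for $n\ge1$, and $P_0=1$. *)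

theory Defs
  imports Main
begin

text \<open>A child is stored together with the color of the edge joining it to its parent.\<close>

datatype tree = Node (root: nat) (children: "(nat \<times> tree) list")

type_synonym forest = "tree list"

fun tree_vertices :: "tree \<Rightarrow> nat list" where
  "tree_vertices (Node v cs) = v # concat (map (\<lambda>(c, t). tree_vertices t) cs)"

definition forest_vertices :: "forest \<Rightarrow> nat list" where
  "forest_vertices F = concat (map tree_vertices F)"

text \<open>The colors of the edges to the children of each vertex increase weakly from left to right.\<close>

fun k_colored :: "nat \<Rightarrow> tree \<Rightarrow> bool" where
  "k_colored k (Node v cs) \<longleftrightarrow>
     sorted (map fst cs) \<and> (\<forall>(c, t) \<in> set cs. c \<in> {1..k} \<and> k_colored k t)"

text \<open>Distinctness of the labels makes the vertex set, and not just the set of labels, equal to \<open>[n]\<close>.\<close>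

definition colored_forests :: "nat \<Rightarrow> nat \<Rightarrow> forest set" where
  "colored_forests k n =
     {F. (\<forall>t \<in> set F. k_colored k t) \<and>
         distinct (forest_vertices F) \<and> set (forest_vertices F) = {1..n}}"

definition colored_trees :: "nat \<Rightarrow> nat \<Rightarrow> forest set" where
  "colored_trees k n = {F \<in> colored_forests k n. length F = 1}"

text \<open>\<open>root_path t p\<close>: \<open>p\<close> is the list of vertices on the path from the root of \<open>t\<close> to the vertex
  \<open>last p\<close>, both ends included.\<close>

inductive root_path :: "tree \<Rightarrow> nat list \<Rightarrow> bool" where
  root: "root_path (Node v cs) [v]"
| child: "(c, t) \<in> set cs \<Longrightarrow> root_path t p \<Longrightarrow> root_path (Node v cs) (v # p)"

definition proper_descendant :: "forest \<Rightarrow> nat \<Rightarrow> nat \<Rightarrow> bool" where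
  "proper_descendant F v w \<longleftrightarrow>
     w \<noteq> v \<and> (\<exists>t \<in> set F. \<exists>p. root_path t p \<and> last p = w \<and> v \<in> set p)"

definition proper_vertex :: "forest \<Rightarrow> nat \<Rightarrow> bool" where
  "proper_vertex F v \<longleftrightarrow> (\<forall>w. proper_descendant F v w \<longrightarrow> v < w)"

definition "prop" :: "forest \<Rightarrow> nat" where
  "prop F = card {v \<in> set (forest_vertices F). proper_vertex F v}"

definition P :: "nat \<Rightarrow> 'a::comm_ring_1 \<Rightarrow> 'a \<Rightarrow> 'a \<Rightarrow> 'a" where
  "P n a b c =
     (if n = 0 then 1 else c * (\<Prod>i = 1..n - 1. of_nat i * a + of_nat (n - i) * b + c))"

end

theory Submission
  imports Defs
begin

text \<open>
  Write \<open>F\<close> and \<open>T\<close> for the exponential generating functions of forests and trees. Clearly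
  \<open>F = 1 / (1 - T)\<close>. A tree is a root together with one forest for each of the \<open>k\<close> colors, and the
  root is proper iff it carries the least label, so \<open>T\<^sub>n = (n - 1 + u) (F\<^sup>k)\<^sub>n\<^sub>-\<^sub>1\<close>.
  For fixed \<open>a\<close> and \<open>b\<close> the polynomials \<open>P\<^sub>n(a,b,c)\<close> are of binomial type in \<open>c\<close>
  (a form of the Rothe--Hagen identity), so if \<open>F\<close> belongs to \<open>c = u\<close>, then \<open>F\<^sup>k\<close> belongs to
  \<open>c = k u\<close> and \<open>1 - T\<close> to \<open>c = - u\<close>. For \<open>a = k\<close> and \<open>b = (k + 1) u\<close> the
  recurrence for \<open>T\<close> then holds factor by factor.
\<close>

section \<open>The convolution identity\<close>

definition rising :: "'a::comm_ring_1 \<Rightarrow> 'a \<Rightarrow> nat \<Rightarrow> 'a" where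
  "rising h x n = (\<Prod>i<n. x + of_nat i * h)"

lemma rising_0 [simp]: "rising h x 0 = 1"
  by (simp add: rising_def)

lemma rising_Suc: "rising h x (Suc n) = rising h x n * (x + of_nat n * h)"
  by (simp add: rising_def)

lemma rising_Suc_shift: "rising h x (Suc n) = x * rising h (x + h) n"
  unfolding rising_def by (subst prod.lessThan_Suc_shift) (simp add: algebra_simps)

lemma rising_add: "rising h x (m + n) = rising h x m * rising h (x + of_nat m * h) n"
  by (induction n) (simp_all add: rising_Suc algebra_simps)

text \<open>Each factor is the negative of some \<open>x - i h\<close>; read backwards, these form
  an ascending run from \<open>x - (n - 1) h\<close>.\<close>

lemma rising_minus: "rising h (- x) n = (- 1) ^ n * rising h (x - of_nat n * h + h) n"
proof (induction n arbitrary: x)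
  case (Suc n)
  have "rising h (- x) (Suc n) = - x * rising h (- (x - h)) n"
    by (simp add: rising_Suc_shift)
  also have "\<dots> = - x * ((- 1) ^ n * rising h (x - h - of_nat n * h + h) n)"
    by (simp only: Suc.IH)
  also have "\<dots> = (- 1) ^ Suc n * rising h (x - of_nat (Suc n) * h + h) (Suc n)"
    by (simp add: rising_Suc algebra_simps)
  finally show ?case .
qed simp

text \<open>Vandermonde: the new factor \<open>x + y + n h\<close> splits as
  \<open>(x + j h) + (y + (n - j) h)\<close>, each summand prolongs one of the two runs, and
  Pascal's rule collects the terms.\<close>

lemma rising_add_arg:
  "rising h (x + y) n = (\<Sum>j\<le>n. of_nat (n choose j) * rising h x j * rising h y (n - j))"
proof (induction n)
  case (Suc n)
  let ?X = "rising h x" and ?Y = "rising h y"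
  have "rising h (x + y) (Suc n) =
      (\<Sum>j\<le>n. of_nat (n choose j) * ?X j * ?Y (n - j) * (x + y + of_nat n * h))"
    by (simp add: rising_Suc Suc.IH sum_distrib_right)
  also have "\<dots> = (\<Sum>j\<le>n. of_nat (n choose j) * ?X (Suc j) * ?Y (n - j)
      + of_nat (n choose j) * ?X j * ?Y (Suc n - j))"
  proof (rule sum.cong)
    fix j assume "j \<in> {..n}"
    then obtain i where "n = j + i" using le_iff_add by auto
    then show "of_nat (n choose j) * ?X j * ?Y (n - j) * (x + y + of_nat n * h) =
      of_nat (n choose j) * ?X (Suc j) * ?Y (n - j) + of_nat (n choose j) * ?X j * ?Y (Suc n - j)"
      by (simp add: rising_Suc algebra_simps Suc_diff_le)
  qed simp
  also have "\<dots> = (\<Sum>j\<le>n. of_nat (n choose j) * ?X (Suc j) * ?Y (n - j))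
      + (\<Sum>j\<le>Suc n. of_nat (n choose j) * ?X j * ?Y (Suc n - j))"
    by (simp add: sum.distrib binomial_eq_0)
  also have "\<dots> = (\<Sum>j\<le>Suc n. of_nat (Suc n choose j) * ?X j * ?Y (Suc n - j))"
    by (simp only: sum.atMost_Suc_shift) (simp add: sum.distrib[symmetric] algebra_simps)
  finally show ?case .
qed simp

text \<open>The product is a polynomial in \<open>m\<close> of degree below \<open>M\<close>, so its
  \<open>M\<close>-th difference vanishes. In the induction the last factor is taken apart: its
  multiple of \<open>m\<close> is absorbed into the binomial coefficient, and the resulting index
  shift adds \<open>\<beta>\<close> to every \<open>\<alpha> s\<close>, hence the arbitrary
  family.\<close>

lemma alternating_binomial_sum_prod_eq_0:
  fixes \<alpha> :: "nat \<Rightarrow> 'a::comm_ring_1"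
  assumes "t < M"
  shows "(\<Sum>m\<le>M. (- 1) ^ m * of_nat (M choose m) * (\<Prod>s<t. \<alpha> s + of_nat m * \<beta>)) = 0"
  using assms
proof (induction t arbitrary: M \<alpha>)
  case 0
  then show ?case by (simp add: choose_alternating_sum)
next
  case (Suc t)
  then obtain N where M: "M = Suc N" and t: "t < N" by (cases M) auto
  let ?f = "\<lambda>m. \<Prod>s<t. \<alpha> s + of_nat m * \<beta>"
  have absorb: "of_nat (Suc m) * of_nat (M choose Suc m) = (of_nat M * of_nat (N choose m) :: 'a)" for m
    unfolding M of_nat_mult[symmetric] by (simp only: Suc_times_binomial)
  have "(\<Sum>m\<le>M. (- 1) ^ m * of_nat (M choose m) * (\<Prod>s<Suc t. \<alpha> s + of_nat m * \<beta>)) =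
      \<alpha> t * (\<Sum>m\<le>M. (- 1) ^ m * of_nat (M choose m) * ?f m) +
      \<beta> * (\<Sum>m\<le>M. (- 1) ^ m * (of_nat m * of_nat (M choose m)) * ?f m)"
    by (simp add: sum_distrib_left sum.distrib[symmetric] algebra_simps)
  also have "(\<Sum>m\<le>M. (- 1) ^ m * of_nat (M choose m) * ?f m) = 0"
    using Suc.IH[of M \<alpha>] Suc.prems by simp
  also have "(\<Sum>m\<le>M. (- 1) ^ m * (of_nat m * of_nat (M choose m)) * ?f m) =
      (\<Sum>m\<le>N. (- 1) ^ Suc m * (of_nat (Suc m) * of_nat (M choose Suc m)) * ?f (Suc m))"
    unfolding M by (subst sum.atMost_Suc_shift) simp
  also have "\<dots> = - of_nat M * (\<Sum>m\<le>N. (- 1) ^ m * of_nat (N choose m) *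
      (\<Prod>s<t. (\<alpha> s + \<beta>) + of_nat m * \<beta>))"
    unfolding absorb by (simp add: sum_distrib_left algebra_simps sum_negf)
  also have "(\<Sum>m\<le>N. (- 1) ^ m * of_nat (N choose m) * (\<Prod>s<t. (\<alpha> s + \<beta>) + of_nat m * \<beta>)) = 0"
    by (rule Suc.IH[OF t])
  finally show ?case by simp
qed

section \<open>The polynomials \<open>P\<close> as rising factorials, and their convolution\<close>

lemma P_0 [simp]: "P 0 a b c = 1"
  by (simp add: P_def)

text \<open>The \<open>i\<close>-th factor is \<open>c + (n + 1) b + i (a - b)\<close>, an
  arithmetic progression in \<open>i\<close>. It begins at \<open>i = 1\<close>, hence the extra
  \<open>a - b\<close>.\<close>

lemma P_Suc_eq_rising: "P (Suc n) a b c = c * rising (a - b) (c + of_nat (Suc n) * b + (a - b)) n"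
proof -
  have "(\<Prod>i = 1..n. of_nat i * a + of_nat (Suc n - i) * b + c)
      = (\<Prod>i<n. of_nat (Suc i) * a + of_nat (n - i) * b + c)"
    by (rule prod.reindex_bij_witness[of _ Suc "\<lambda>i. i - 1"]) auto
  also have "\<dots> = rising (a - b) (c + of_nat (Suc n) * b + (a - b)) n"
    unfolding rising_def by (rule prod.cong) (auto simp: of_nat_diff algebra_simps)
  finally show ?thesis by (simp add: P_def)
qed

text \<open>Both factors are runs of the same arithmetic progression; they join to a product of
  \<open>M - 1\<close> factors that are affine in \<open>m\<close>, which an \<open>M\<close>-th difference annihilates.\<close>

lemma P_times_rising:
  assumes "m \<le> M" "M > 0"
  shows "P m a b c * rising (a - b) (- (c + of_nat m * b)) (M - m) =
    (- 1) ^ (M - m) * c * (\<Prod>s<M - 1. (c - of_nat (M - 1) * (a - b) + of_nat s * (a - b)) + of_nat m * a)"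
proof -
  define h where "h = a - b"
  define r where "r = M - m"
  have b: "b = a - h" and M: "M = m + r" using assms by (auto simp: h_def r_def)
  have prod: "(\<Prod>s<M - 1. (c - of_nat (M - 1) * h + of_nat s * h) + of_nat m * a) =
      rising h (c + of_nat m * a - of_nat (M - 1) * h) (M - 1)"
    by (simp add: rising_def algebra_simps)
  show ?thesis
  proof (cases m)
    case 0
    then obtain r' where r': "r = Suc r'" using assms M by (cases r) auto
    \<comment> \<open>\<open>P 0 a b c\<close> has no factor \<open>c\<close>; the reversed run
      supplies it as its last entry.\<close>
    have "rising h (- c) (Suc r') = (- 1) ^ Suc r' * (rising h (c - of_nat r' * h) r' * c)"
      unfolding rising_minus by (simp add: rising_Suc algebra_simps)
    then show ?thesis unfolding h_def[symmetric] prod r_def[symmetric]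
      using 0 M r' by (simp add: mult_ac)
  next
    case (Suc m')
    \<comment> \<open>Reversing the second factor gives a run ending at \<open>c + m b\<close>; the
      run of \<open>P m a b c\<close> takes over at \<open>c + m b + h\<close>.\<close>
    have "rising h (c + of_nat m * b - of_nat r * h + h) (r + m') =
       rising h (c + of_nat m * b - of_nat r * h + h) r * rising h (c + of_nat m * b + h) m'"
      unfolding rising_add by (simp add: algebra_simps)
    moreover have "c + of_nat m * a - of_nat (M - 1) * h = c + of_nat m * b - of_nat r * h + h"
      using M Suc by (simp add: b algebra_simps)
    moreover have "M - 1 = r + m'" using M Suc by simp
    ultimately have "(\<Prod>s<M - 1. (c - of_nat (M - 1) * h + of_nat s * h) + of_nat m * a) =
       rising h (c + of_nat m * b - of_nat r * h + h) r * rising h (c + of_nat m * b + h) m'"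
      unfolding prod by (simp only:)
    moreover have "P m a b c = c * rising h (c + of_nat m * b + h) m'"
      unfolding Suc h_def by (rule P_Suc_eq_rising)
    ultimately show ?thesis unfolding h_def[symmetric] r_def[symmetric] rising_minus
      by (simp only: mult_ac)
  qed
qed

text \<open>A one-sided Rothe-Hagen identity. With \<open>z = c + d + n b\<close> one has
  \<open>d + (n - m) b = z - (c + m b)\<close>, so the Vandermonde identity separates
  \<open>z\<close> from \<open>m\<close>. After the sums are exchanged, the inner one is an
  alternating sum that vanishes unless \<open>j = n\<close>.\<close>

lemma sum_P_times_rising:
  "(\<Sum>m\<le>n. of_nat (n choose m) * P m a b c * rising (a - b) (d + of_nat (n - m) * b) (n - m)) =
    rising (a - b) (c + d + of_nat n * b) n"
proof -
  define h where "h = a - b"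
  define z where "z = c + d + of_nat n * b"
  let ?D = "\<lambda>M. \<Sum>m\<le>M. of_nat (M choose m) * (P m a b c * rising h (- (c + of_nat m * b)) (M - m))"
  have D0: "?D M = 0" if "M > 0" for M
  proof -
    have sign: "(- 1) ^ (M - m) = ((- 1) ^ M * (- 1) ^ m :: 'a)" if "m \<le> M" for m
    proof -
      have "(- 1) ^ M * (- 1) ^ m = ((- 1) ^ (M - m) * (- 1) ^ (2 * m) :: 'a)"
        unfolding power_add[symmetric] using that by (simp add: mult_2)
      then show ?thesis by simp
    qed
    have "?D M = (\<Sum>m\<le>M. (- 1) ^ M * c * ((- 1) ^ m * of_nat (M choose m) *
        (\<Prod>s<M - 1. (c - of_nat (M - 1) * h + of_nat s * h) + of_nat m * a)))"
    proof (rule sum.cong)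
      fix m assume "m \<in> {..M}"
      then have m: "m \<le> M" by simp
      show "of_nat (M choose m) * (P m a b c * rising h (- (c + of_nat m * b)) (M - m)) =
          (- 1) ^ M * c * ((- 1) ^ m * of_nat (M choose m) *
          (\<Prod>s<M - 1. (c - of_nat (M - 1) * h + of_nat s * h) + of_nat m * a))"
        unfolding h_def P_times_rising[OF m that] sign[OF m] by (simp only: mult_ac)
    qed simp
    also have "\<dots> = 0"
      unfolding sum_distrib_left[symmetric]
      using that by (subst alternating_binomial_sum_prod_eq_0) auto
    finally show ?thesis .
  qed
  have "(\<Sum>m\<le>n. of_nat (n choose m) * P m a b c * rising h (d + of_nat (n - m) * b) (n - m)) =
      (\<Sum>m\<le>n. \<Sum>j\<le>n - m. of_nat ((n choose m) * (n - m choose j)) * P m a b c *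
         (rising h z j * rising h (- (c + of_nat m * b)) (n - m - j)))"
  proof (rule sum.cong)
    fix m assume "m \<in> {..n}"
    then have "d + of_nat (n - m) * b = z + - (c + of_nat m * b)"
      by (simp add: z_def of_nat_diff algebra_simps)
    then show "of_nat (n choose m) * P m a b c * rising h (d + of_nat (n - m) * b) (n - m) =
       (\<Sum>j\<le>n - m. of_nat ((n choose m) * (n - m choose j)) * P m a b c *
         (rising h z j * rising h (- (c + of_nat m * b)) (n - m - j)))"
      by (simp only: rising_add_arg) (simp add: sum_distrib_left mult_ac)
  qed simp
  also have "\<dots> = (\<Sum>m\<le>n. \<Sum>j | j \<in> {..n} \<and> m + j \<le> n.
      of_nat ((n choose m) * (n - m choose j)) * P m a b c *
         (rising h z j * rising h (- (c + of_nat m * b)) (n - m - j)))"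
    by (intro sum.cong) auto
  also have "\<dots> = (\<Sum>j\<le>n. \<Sum>m | m \<in> {..n} \<and> m + j \<le> n.
      of_nat ((n choose m) * (n - m choose j)) * P m a b c *
         (rising h z j * rising h (- (c + of_nat m * b)) (n - m - j)))"
    by (rule sum.swap_restrict) auto
  also have "\<dots> = (\<Sum>j\<le>n. of_nat (n choose j) * rising h z j * ?D (n - j))"
  proof (rule sum.cong)
    fix j assume "j \<in> {..n}"
    then have j: "j \<le> n" by simp
    have "(\<Sum>m | m \<in> {..n} \<and> m + j \<le> n. of_nat ((n choose m) * (n - m choose j)) * P m a b c *
         (rising h z j * rising h (- (c + of_nat m * b)) (n - m - j))) =
       (\<Sum>m\<le>n - j. of_nat ((n choose m) * (n - m choose j)) * P m a b c *
         (rising h z j * rising h (- (c + of_nat m * b)) (n - m - j)))"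
      using j by (intro sum.cong) auto
    also have "\<dots> = (\<Sum>m\<le>n - j. of_nat (n choose j) * rising h z j * (of_nat (n - j choose m) *
        (P m a b c * rising h (- (c + of_nat m * b)) (n - j - m))))"
    proof (rule sum.cong)
      fix m assume "m \<in> {..n - j}"
      with j have m: "m + j \<le> n" by auto
      \<comment> \<open>The trinomial coefficient of \<open>m\<close>, \<open>j\<close> and
        \<open>n - m - j\<close> is regrouped so that a factor free of \<open>m\<close> can leave
        the inner sum.\<close>
      have "(n choose m) * (n - m choose j) = (n choose (m + j)) * (m + j choose m)"
        using choose_mult[of m "m + j" n] m by simp
      also have "\<dots> = (n choose j) * (n - j choose m)"
        using choose_mult[of j "m + j" n] m binomial_symmetric[of m "m + j"] by simp
      finally have C: "(n choose m) * (n - m choose j) = (n choose j) * (n - j choose m)" .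
      have "n - m - j = n - j - m" by simp
      then show "of_nat ((n choose m) * (n - m choose j)) * P m a b c *
          (rising h z j * rising h (- (c + of_nat m * b)) (n - m - j)) =
          of_nat (n choose j) * rising h z j * (of_nat (n - j choose m) *
          (P m a b c * rising h (- (c + of_nat m * b)) (n - j - m)))"
        unfolding C by (simp add: mult_ac)
    qed simp
    finally show "(\<Sum>m | m \<in> {..n} \<and> m + j \<le> n. of_nat ((n choose m) * (n - m choose j)) * P m a b c *
         (rising h z j * rising h (- (c + of_nat m * b)) (n - m - j))) =
         of_nat (n choose j) * rising h z j * ?D (n - j)"
      by (simp only: sum_distrib_left)
  qed simp
  also have "\<dots> = (\<Sum>j\<le>n. if j = n then rising h z n else 0)"
  proof (rule sum.cong)
    fix j assume "j \<in> {..n}"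
    then show "of_nat (n choose j) * rising h z j * ?D (n - j) = (if j = n then rising h z n else 0)"
      using D0[of "n - j"] by (cases "j = n") (simp_all only: atMost_iff zero_less_diff, simp_all)
  qed simp
  also have "\<dots> = rising h z n" by simp
  finally show ?thesis unfolding h_def z_def .
qed

text \<open>Write the leading \<open>c\<close> as \<open>(c + n b) - n b\<close>; for
  \<open>n = 0\<close> the truncated \<open>n - 1\<close> is harmless, since its coefficient is 0.
  Both terms have the shape that the one-sided identity sums.\<close>

lemma P_eq_rising_diff:
  "P n a b c = rising (a - b) (c + of_nat n * b) n
     - of_nat n * b * rising (a - b) (c + a + of_nat (n - 1) * b) (n - 1)"
  by (cases n) (simp_all add: P_Suc_eq_rising rising_Suc_shift algebra_simps)

text \<open>Expanding \<open>P (n - m) a b d\<close> as a difference leaves two one-sided sums, the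
  second with \<open>d + a\<close> for \<open>d\<close> and one order lower. The same difference
  formula recombines their values.\<close>

lemma P_convolution:
  "(\<Sum>m\<le>n. of_nat (n choose m) * P m a b c * P (n - m) a b d) = P n a b (c + d)"
proof (cases n)
  case (Suc n')
  let ?R = "rising (a - b)"
  have "(\<Sum>m\<le>n. of_nat (n choose m) * P m a b c * P (n - m) a b d) =
     (\<Sum>m\<le>n. of_nat (n choose m) * P m a b c * ?R (d + of_nat (n - m) * b) (n - m)) -
     (\<Sum>m\<le>n. of_nat ((n choose m) * (n - m)) * b * P m a b c *
         ?R (d + a + of_nat (n - m - 1) * b) (n - m - 1))"
    unfolding sum_subtractf[symmetric]
    by (rule sum.cong) (simp_all add: P_eq_rising_diff[of "n - _"] algebra_simps)
  \<comment> \<open>Absorption, \<open>(n - m) (n choose m) = n (n - 1 choose m)\<close>; the term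
    at \<open>m = n\<close> is 0.\<close>
  also have "(\<Sum>m\<le>n. of_nat ((n choose m) * (n - m)) * b * P m a b c *
         ?R (d + a + of_nat (n - m - 1) * b) (n - m - 1)) =
      (\<Sum>m\<le>n'. of_nat n * b * (of_nat (n' choose m) * P m a b c *
         ?R (d + a + of_nat (n' - m) * b) (n' - m)))"
  proof -
    have "of_nat ((Suc n' choose m) * (Suc n' - m)) = (of_nat (Suc n') * of_nat (n' choose m) :: 'a)" for m
      unfolding of_nat_mult[symmetric] using binomial_absorb_comp[of "Suc n'" m]
      by (simp add: mult.commute)
    then show ?thesis unfolding Suc by (simp add: mult_ac binomial_eq_0 del: of_nat_mult of_nat_Suc)
  qed
  also have "\<dots> = of_nat n * b * ?R (c + (d + a) + of_nat n' * b) n'"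
    unfolding sum_distrib_left[symmetric] sum_P_times_rising ..
  finally show ?thesis
    unfolding sum_P_times_rising P_eq_rising_diff[of n a b "c + d"] using Suc by (simp add: add_ac)
qed simp

section \<open>Proper vertices\<close>

lemma forest_vertices_Nil [simp]: "forest_vertices [] = []"
  and forest_vertices_Cons [simp]: "forest_vertices (t # F) = tree_vertices t @ forest_vertices F"
  and forest_vertices_append [simp]: "forest_vertices (F @ G) = forest_vertices F @ forest_vertices G"
  by (simp_all add: forest_vertices_def)

lemma tree_vertices_Node: "tree_vertices (Node v cs) = v # forest_vertices (map snd cs)"
  by (auto simp: forest_vertices_def comp_def case_prod_beta intro!: arg_cong[where f = concat])

declare tree_vertices.simps [simp del] tree_vertices_Node [simp]

lemma set_forest_vertices: "set (forest_vertices F) = (\<Union>t\<in>set F. set (tree_vertices t))"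
  by (simp add: forest_vertices_def)

lemma root_path_subset: "root_path t p \<Longrightarrow> p \<noteq> [] \<and> set p \<subseteq> set (tree_vertices t)"
  by (induction rule: root_path.induct) (fastforce simp: set_forest_vertices)+

lemma root_path_exists:
  "w \<in> set (tree_vertices t) \<Longrightarrow> \<exists>p. root_path t p \<and> last p = w"
proof (induction t)
  case (Node v cs)
  show ?case
  proof (cases "w = v")
    case True
    then show ?thesis using root_path.root by (metis last.simps)
  next
    case False
    with Node.prems obtain c t where ct: "(c, t) \<in> set cs" "w \<in> set (tree_vertices t)"
      by (auto simp: set_forest_vertices)
    with Node.IH[of "(c, t)" t] obtain p where "root_path t p" "last p = w" by auto
    with ct(1) show ?thesis
      using root_path.child root_path_subset by (metis last_ConsR)
  qed
qed

lemma root_path_Node_iff: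
  "root_path (Node v cs) p \<longleftrightarrow> p = [v] \<or> (\<exists>c t q. (c, t) \<in> set cs \<and> root_path t q \<and> p = v # q)"
  by (subst root_path.simps) auto

text \<open>A root path stays inside one tree, and disjointness of the labels determines that tree
  from any vertex on the path.\<close>

lemma proper_descendant_Cons:
  assumes "set (tree_vertices t) \<inter> set (forest_vertices F) = {}"
  shows "v \<in> set (tree_vertices t) \<Longrightarrow> proper_descendant (t # F) v w \<longleftrightarrow> proper_descendant [t] v w"
    and "v \<in> set (forest_vertices F) \<Longrightarrow> proper_descendant (t # F) v w \<longleftrightarrow> proper_descendant F v w"
  using assms root_path_subset unfolding proper_descendant_def set_forest_vertices
  by (simp; blast)+

text \<open>Every root path of the tree starts at \<open>v\<close>, so all other vertices descend
  from the root. For \<open>x\<close> below the root, dropping or adding the head \<open>v\<close>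
  translates between paths in the tree and in the forest.\<close>

lemma proper_descendant_Node:
  assumes "v \<notin> set (forest_vertices (map snd cs))"
  shows "proper_descendant [Node v cs] v w \<longleftrightarrow> w \<in> set (forest_vertices (map snd cs))"
    and "x \<in> set (forest_vertices (map snd cs)) \<Longrightarrow>
      proper_descendant [Node v cs] x w \<longleftrightarrow> proper_descendant (map snd cs) x w"
proof -
  show "proper_descendant [Node v cs] v w \<longleftrightarrow> w \<in> set (forest_vertices (map snd cs))"
  proof
    assume "proper_descendant [Node v cs] v w"
    then obtain p where p: "w \<noteq> v" "root_path (Node v cs) p" "last p = w"
      by (auto simp: proper_descendant_def)
    then have "w \<in> set p" using root_path_subset by (metis last_in_set)
    then show "w \<in> set (forest_vertices (map snd cs))"
      using p root_path_subset[OF p(2)] by auto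
  next
    assume w: "w \<in> set (forest_vertices (map snd cs))"
    then obtain p where p: "root_path (Node v cs) p" "last p = w"
      using root_path_exists[of w "Node v cs"] by auto
    then have "v \<in> set p" by (auto simp: root_path_Node_iff)
    then show "proper_descendant [Node v cs] v w"
      using w p assms by (auto simp: proper_descendant_def)
  qed
next
  assume x: "x \<in> set (forest_vertices (map snd cs))"
  then have "x \<noteq> v" using assms by auto
  show "proper_descendant [Node v cs] x w \<longleftrightarrow> proper_descendant (map snd cs) x w"
  proof
    assume "proper_descendant [Node v cs] x w"
    then obtain p where p: "w \<noteq> x" "root_path (Node v cs) p" "last p = w" "x \<in> set p"
      by (auto simp: proper_descendant_def)
    with \<open>x \<noteq> v\<close> obtain c t q where q: "(c, t) \<in> set cs" "root_path t q" "p = v # q"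
      by (auto simp: root_path_Node_iff)
    then have "last q = w" "x \<in> set q" using p \<open>x \<noteq> v\<close> root_path_subset by auto
    with p(1) q show "proper_descendant (map snd cs) x w"
      by (force simp: proper_descendant_def)
  next
    assume "proper_descendant (map snd cs) x w"
    then obtain c t p where "w \<noteq> x" "(c, t) \<in> set cs" "root_path t p" "last p = w" "x \<in> set p"
      by (auto simp: proper_descendant_def)
    moreover from this have "root_path (Node v cs) (v # p)" "p \<noteq> []"
      using root_path_subset by (blast intro: root_path.child)+
    ultimately show "proper_descendant [Node v cs] x w"
      unfolding proper_descendant_def by (auto intro!: exI[of _ "v # p"])
  qed
qed

section \<open>Additivity of \<open>prop\<close> over trees and at the root\<close>

lemma prop_Nil [simp]: "prop [] = 0"
  by (simp add: prop_def)

lemma prop_Cons: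
  assumes "set (tree_vertices t) \<inter> set (forest_vertices F) = {}"
  shows "prop (t # F) = prop [t] + prop F"
proof -
  have "{v \<in> set (forest_vertices (t # F)). proper_vertex (t # F) v} =
      {v \<in> set (forest_vertices [t]). proper_vertex [t] v} \<union>
      {v \<in> set (forest_vertices F). proper_vertex F v}"
    using proper_descendant_Cons[OF assms] by (auto simp: proper_vertex_def)
  then show ?thesis
    unfolding prop_def using assms by (subst card_Un_disjoint[symmetric]) auto
qed

lemma prop_append:
  assumes "distinct (forest_vertices (F @ G))"
  shows "prop (F @ G) = prop F + prop G"
  using assms
proof (induction F)
  case (Cons t F)
  then have "prop (t # (F @ G)) = prop [t] + (prop F + prop G)" by (subst prop_Cons) auto
  also have "\<dots> = prop (t # F) + prop G" using Cons.prems by (subst (2) prop_Cons) auto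
  finally show ?case by simp
qed simp

lemma prop_Node:
  assumes "v \<notin> set (forest_vertices (map snd cs))"
  shows "prop [Node v cs] =
    (if \<forall>w\<in>set (forest_vertices (map snd cs)). v < w then 1 else 0) + prop (map snd cs)"
proof -
  let ?V = "set (forest_vertices (map snd cs))"
  have "{x \<in> set (forest_vertices [Node v cs]). proper_vertex [Node v cs] x} =
      (if \<forall>w\<in>?V. v < w then {v} else {}) \<union> {x \<in> ?V. proper_vertex (map snd cs) x}"
    using proper_descendant_Node[OF assms] by (auto simp: proper_vertex_def)
  then show ?thesis
    unfolding prop_def using assms by (simp only: card_insert_if) simp
qed

section \<open>Decompositions of trees and forests\<close>

text \<open>An arbitrary label set \<open>A\<close> replaces \<open>[n]\<close>, because
  decompositions distribute the labels over arbitrary subsets.\<close>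

definition forests_on :: "nat \<Rightarrow> nat set \<Rightarrow> forest set" where
  "forests_on k A = {F. (\<forall>t\<in>set F. k_colored k t) \<and>
     distinct (forest_vertices F) \<and> set (forest_vertices F) = A}"

definition trees_on :: "nat \<Rightarrow> nat set \<Rightarrow> tree set" where
  "trees_on k A = {t. k_colored k t \<and> distinct (tree_vertices t) \<and> set (tree_vertices t) = A}"

text \<open>Only the edges to the top level are restricted to the colors \<open>1, \<dots>, j\<close>;
  the trees below may use all \<open>k\<close> colors.\<close>

definition children_on :: "nat \<Rightarrow> nat \<Rightarrow> nat set \<Rightarrow> (nat \<times> tree) list set" where
  "children_on k j A = {cs. sorted (map fst cs) \<and> (\<forall>(c, t)\<in>set cs. c \<in> {1..j} \<and> k_colored k t) \<and>
     distinct (forest_vertices (map snd cs)) \<and> set (forest_vertices (map snd cs)) = A}"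

lemma tree_vertices_nonempty [simp]: "tree_vertices t \<noteq> []"
  by (cases t) simp

lemma trees_on_empty [simp]: "trees_on k {} = {}"
  by (auto simp: trees_on_def)

lemma forest_vertices_eq_Nil [simp]: "forest_vertices F = [] \<longleftrightarrow> F = []"
  by (cases F) auto

lemma forests_on_empty [simp]: "forests_on k {} = {[]}"
  by (auto simp: forests_on_def)

lemma children_on_0: "children_on k 0 A = (if A = {} then {[]} else {})"
proof -
  have "cs = []" if "cs \<in> children_on k 0 A" for cs
    using that by (cases cs) (auto simp: children_on_def)
  moreover have "[] \<in> children_on k 0 A \<longleftrightarrow> A = {}" by (auto simp: children_on_def)
  ultimately show ?thesis by (auto simp del: all_not_in_conv)
qed

text \<open>The combinatorial form of \<open>F = 1 + T F\<close>: the first tree takes the labels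
  \<open>B\<close>, the remaining forest takes \<open>A - B\<close>.\<close>

lemma forests_on_Cons:
  assumes "A \<noteq> {}"
  shows "bij_betw (\<lambda>(B, t, F). t # F) (SIGMA B:Pow A. trees_on k B \<times> forests_on k (A - B)) (forests_on k A)"
proof (rule bij_betwI')
  fix x y
  assume "x \<in> (SIGMA B:Pow A. trees_on k B \<times> forests_on k (A - B))"
    and "y \<in> (SIGMA B:Pow A. trees_on k B \<times> forests_on k (A - B))"
  then show "((\<lambda>(B, t, F). t # F) x = (\<lambda>(B, t, F). t # F) y) = (x = y)"
    by (auto simp: trees_on_def)
next
  fix x assume "x \<in> (SIGMA B:Pow A. trees_on k B \<times> forests_on k (A - B))"
  then show "(\<lambda>(B, t, F). t # F) x \<in> forests_on k A"
    by (auto simp: trees_on_def forests_on_def)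
next
  fix G assume G: "G \<in> forests_on k A"
  with assms obtain t F where "G = t # F" by (cases G) (auto simp: forests_on_def)
  with G show "\<exists>x\<in>SIGMA B:Pow A. trees_on k B \<times> forests_on k (A - B). G = (\<lambda>(B, t, F). t # F) x"
    by (intro bexI[of _ "(set (tree_vertices t), t, F)"])
      (auto simp: trees_on_def forests_on_def)
qed

lemma trees_on_Node:
  "bij_betw (\<lambda>(r, cs). Node r cs) (SIGMA r:A. children_on k k (A - {r})) (trees_on k A)"
proof (rule bij_betwI')
  fix t assume t: "t \<in> trees_on k A"
  obtain r cs where "t = Node r cs" by (cases t)
  with t show "\<exists>x\<in>SIGMA r:A. children_on k k (A - {r}). t = (\<lambda>(r, cs). Node r cs) x"
    by (intro bexI[of _ "(r, cs)"]) (auto simp: trees_on_def children_on_def)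
qed (auto simp: trees_on_def children_on_def)

text \<open>In a sorted list the entries of the largest color form a suffix, whose common color can
  be stripped and restored.\<close>

lemma sorted_split_top:
  assumes "sorted (map fst cs)" "\<forall>c\<in>fst ` set cs. c \<le> Suc j"
  shows "cs = filter (\<lambda>x. fst x \<le> j) cs @ map (Pair (Suc j)) (map snd (filter (\<lambda>x. fst x = Suc j) cs))"
  using assms
proof (induction cs)
  case (Cons x cs)
  show ?case
  proof (cases "fst x \<le> j")
    case False
    with Cons.prems have "fst x = Suc j" by auto
    moreover from this Cons.prems have "\<forall>y\<in>set cs. fst y = Suc j" by force
    then have "filter (\<lambda>x. fst x \<le> j) cs = []" by (auto simp: filter_empty_conv)
    ultimately show ?thesis using Cons by (cases x) auto
  qed (use Cons in auto)
qed simp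

text \<open>The edges of color \<open>Suc j\<close> lead to an arbitrary forest, so each further
  color contributes one factor of the forest generating function.\<close>

lemma children_on_Suc:
  "bij_betw (\<lambda>(B, cs, F). cs @ map (Pair (Suc j)) F)
     (SIGMA B:Pow A. children_on k j B \<times> forests_on k (A - B)) (children_on k (Suc j) A)"
proof (rule bij_betwI')
  fix x y
  assume x: "x \<in> (SIGMA B:Pow A. children_on k j B \<times> forests_on k (A - B))"
    and y: "y \<in> (SIGMA B:Pow A. children_on k j B \<times> forests_on k (A - B))"
  show "((\<lambda>(B, cs, F). cs @ map (Pair (Suc j)) F) x = (\<lambda>(B, cs, F). cs @ map (Pair (Suc j)) F) y) = (x = y)"
  proof
    obtain B cs F where x': "x = (B, cs, F)" by (cases x)
    obtain B' cs' F' where y': "y = (B', cs', F')" by (cases y)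
    \<comment> \<open>The colors at most \<open>j\<close> mark where the concatenation splits, so
      both parts can be recovered from it.\<close>
    have low: "filter (\<lambda>x. fst x \<le> j) (ds @ map (Pair (Suc j)) H) = ds"
      if "ds \<in> children_on k j C" for ds H C
      using that by (auto simp: children_on_def filter_id_conv filter_empty_conv)
    assume "(\<lambda>(B, cs, F). cs @ map (Pair (Suc j)) F) x = (\<lambda>(B, cs, F). cs @ map (Pair (Suc j)) F) y"
    then have eq: "cs @ map (Pair (Suc j)) F = cs' @ map (Pair (Suc j)) F'" by (simp add: x' y')
    have cs: "cs = cs'" using low[of cs B F] low[of cs' B' F'] eq x y by (auto simp: x' y')
    then have "map snd (map (Pair (Suc j)) F) = map snd (map (Pair (Suc j)) F')" using eq by simp
    then have "F = F'" by (simp add: comp_def)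
    moreover have "B = B'" using cs x y by (auto simp: x' y' children_on_def)
    ultimately show "x = y" using cs by (simp add: x' y')
  qed simp
next
  fix x assume "x \<in> (SIGMA B:Pow A. children_on k j B \<times> forests_on k (A - B))"
  then obtain B cs F where x: "x = (B, cs, F)" "B \<subseteq> A" and cs: "cs \<in> children_on k j B"
    and F: "F \<in> forests_on k (A - B)" by auto
  have "sorted (map fst (cs @ map (Pair (Suc j)) F))"
    using cs by (force simp: children_on_def sorted_append comp_def map_replicate_const)
  moreover have "\<forall>(c, t)\<in>set (cs @ map (Pair (Suc j)) F). c \<in> {1..Suc j} \<and> k_colored k t"
    using cs F by (fastforce simp: children_on_def forests_on_def)
  moreover have "map snd (cs @ map (Pair (Suc j)) F) = map snd cs @ F" by (simp add: comp_def)
  then have "distinct (forest_vertices (map snd (cs @ map (Pair (Suc j)) F)))"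
    "set (forest_vertices (map snd (cs @ map (Pair (Suc j)) F))) = A"
    using cs F x(2) by (auto simp: children_on_def forests_on_def)
  ultimately show "(\<lambda>(B, cs, F). cs @ map (Pair (Suc j)) F) x \<in> children_on k (Suc j) A"
    unfolding x children_on_def prod.case by blast
next
  fix cs assume cs: "cs \<in> children_on k (Suc j) A"
  define ds where "ds = filter (\<lambda>x. fst x \<le> j) cs"
  define F where "F = map snd (filter (\<lambda>x. fst x = Suc j) cs)"
  have eq: "cs = ds @ map (Pair (Suc j)) F"
    unfolding ds_def F_def using cs by (intro sorted_split_top) (auto simp: children_on_def)
  have "map snd cs = map snd ds @ F" by (subst eq) (simp add: comp_def)
  then have d: "distinct (forest_vertices (map snd ds @ F))" "set (forest_vertices (map snd ds @ F)) = A"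
    using cs by (auto simp: children_on_def)
  have "ds \<in> children_on k j (set (forest_vertices (map snd ds)))"
    using cs d by (auto simp: children_on_def ds_def sorted_map sorted_wrt_filter)
  moreover have "F \<in> forests_on k (A - set (forest_vertices (map snd ds)))"
    using cs d by (auto simp: children_on_def forests_on_def F_def)
  ultimately show "\<exists>x\<in>SIGMA B:Pow A. children_on k j B \<times> forests_on k (A - B).
      cs = (\<lambda>(B, cs, F). cs @ map (Pair (Suc j)) F) x"
    using d eq by (intro bexI[of _ "(set (forest_vertices (map snd ds)), ds, F)"]) auto
qed

section \<open>Enumeration\<close>

lemma P_of_zero: "P n a b 0 = (if n = 0 then 1 else 0)"
  by (simp add: P_def)

text \<open>The product rule for exponential generating functions, at the level of sets. Finiteness
  is asked of the products \<open>X B \<times> Y (A - B)\<close>, so that an empty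
  \<open>X {}\<close> settles the case in which \<open>Y A\<close> is itself the set under
  study.\<close>

lemma sum_disjoint_product:
  fixes w :: "'z \<Rightarrow> 'a::comm_semiring_1"
  assumes bij: "bij_betw (\<lambda>(B, x, y). f x y) (SIGMA B:Pow A. X B \<times> Y (A - B)) Z"
    and fin: "finite A" "\<And>B. B \<subseteq> A \<Longrightarrow> finite (X B \<times> Y (A - B))"
    and w: "\<And>B x y. x \<in> X B \<Longrightarrow> y \<in> Y (A - B) \<Longrightarrow> w (f x y) = wx x * wy y"
  shows "finite Z" "sum w Z = (\<Sum>B\<in>Pow A. sum wx (X B) * sum wy (Y (A - B)))"
proof -
  have "finite (SIGMA B:Pow A. X B \<times> Y (A - B))"
    by (intro finite_SigmaI[of "Pow A"]) (simp_all add: fin del: finite_cartesian_product_iff)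
  then show "finite Z" using bij_betw_finite[OF bij] by blast
  have "sum w Z = (\<Sum>p\<in>(SIGMA B:Pow A. X B \<times> Y (A - B)). w (case p of (B, x, y) \<Rightarrow> f x y))"
    by (rule sum.reindex_bij_betw[OF bij, symmetric])
  also have "\<dots> = (\<Sum>(B, p)\<in>(SIGMA B:Pow A. X B \<times> Y (A - B)). case p of (x, y) \<Rightarrow> wx x * wy y)"
    by (rule sum.cong) (auto simp: w)
  also have "\<dots> = (\<Sum>B\<in>Pow A. \<Sum>(x, y)\<in>X B \<times> Y (A - B). wx x * wy y)"
    using fin by (intro sum.Sigma[symmetric]) auto
  finally show "sum w Z = (\<Sum>B\<in>Pow A. sum wx (X B) * sum wy (Y (A - B)))"
    by (simp add: sum_product sum.cartesian_product)
qed

text \<open>Grouping by size turns sums over label splittings into the binomial sums of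
  \<open>P_convolution\<close>.\<close>

lemma sum_Pow_card:
  fixes g :: "nat \<Rightarrow> 'a::comm_semiring_1"
  assumes "finite A"
  shows "(\<Sum>B\<in>Pow A. g (card B)) = (\<Sum>m\<le>card A. of_nat (card A choose m) * g m)"
proof -
  have "(\<Sum>B\<in>Pow A. g (card B)) = (\<Sum>m\<le>card A. \<Sum>B | B \<in> Pow A \<and> card B = m. g (card B))"
    using assms by (intro sum.group[symmetric]) (auto intro: card_mono)
  also have "\<dots> = (\<Sum>m\<le>card A. of_nat (card {B. B \<subseteq> A \<and> card B = m}) * g m)"
    by (intro sum.cong) auto
  finally show ?thesis by (simp add: n_subsets[OF assms])
qed

section \<open>Generating functions of trees, lists of children and forests\<close>

context
  fixes k :: nat and u :: "'a::comm_ring_1"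
begin

text \<open>Only \<open>c\<close> varies: \<open>u\<close> for forests, \<open>j u\<close> for
  children in \<open>j\<close> colors, and, up to sign, \<open>- u\<close> for trees.\<close>

abbreviation (input) Q :: "nat \<Rightarrow> 'a \<Rightarrow> 'a" where
  "Q n c \<equiv> P n (of_nat k) (of_nat (k + 1) * u) c"

text \<open>The recurrence behind root removal. For positive \<open>n\<close> both runs start at the
  same \<open>x\<close>, because \<open>- u + (n + 1) (k + 1) u = k u + n (k + 1) u\<close>. The
  longer one has the further last factor \<open>k (n + u)\<close>, whose \<open>k\<close> completes
  \<open>u\<close> to the leading \<open>k u\<close>.\<close>

lemma P_minus_u: "Q (Suc n) (- u) = - (of_nat n + u) * Q n (of_nat k * u)"
proof (cases n)
  case 0
  then show ?thesis by (simp add: P_def)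
next
  case (Suc m)
  define h where "h = of_nat k - of_nat (k + 1) * u"
  define x where "x = of_nat k * u + of_nat (Suc m) * (of_nat (k + 1) * u) + h"
  have x: "- u + of_nat (Suc n) * (of_nat (k + 1) * u) + h = x"
    by (simp add: x_def Suc algebra_simps)
  have "x + of_nat m * h = of_nat k * (of_nat n + u)"
    by (simp add: x_def h_def Suc algebra_simps)
  then have "rising h x n = rising h x m * (of_nat k * (of_nat n + u))"
    by (simp add: Suc rising_Suc)
  moreover have "Q (Suc n) (- u) = - u * rising h x n"
    unfolding P_Suc_eq_rising h_def[symmetric] x ..
  moreover have "Q n (of_nat k * u) = of_nat k * u * rising h x m"
    unfolding Suc P_Suc_eq_rising h_def[symmetric] x_def ..
  ultimately show ?thesis by (simp only:) (simp add: algebra_simps)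
qed

text \<open>The root is proper exactly when it is \<open>Min A\<close>. Summed over all roots this
  gives the factor \<open>card A - 1 + u\<close>, and \<open>P_minus_u\<close> identifies the
  product.\<close>

lemma sum_trees_on:
  assumes fin: "finite A" and ne: "A \<noteq> {}"
    and children: "\<And>r. r \<in> A \<Longrightarrow> finite (children_on k k (A - {r})) \<and>
      (\<Sum>cs\<in>children_on k k (A - {r}). u ^ prop (map snd cs)) = Q (card A - 1) (of_nat k * u)"
  shows "finite (trees_on k A)" "(\<Sum>t\<in>trees_on k A. u ^ prop [t]) = - Q (card A) (- u)"
proof -
  let ?S = "SIGMA r:A. children_on k k (A - {r})"
  have "finite ?S" using fin children by (intro finite_SigmaI) auto
  then show "finite (trees_on k A)" using bij_betw_finite[OF trees_on_Node] by blast
  have "(\<Sum>t\<in>trees_on k A. u ^ prop [t]) = (\<Sum>p\<in>?S. u ^ prop [case p of (r, cs) \<Rightarrow> Node r cs])"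
    by (rule sum.reindex_bij_betw[OF trees_on_Node, symmetric])
  also have "\<dots> = (\<Sum>(r, cs)\<in>?S. (if r = Min A then u else 1) * u ^ prop (map snd cs))"
  proof (rule sum.cong)
    fix p assume "p \<in> ?S"
    then obtain r cs where p: "p = (r, cs)" "r \<in> A" "cs \<in> children_on k k (A - {r})" by auto
    then have V: "set (forest_vertices (map snd cs)) = A - {r}" by (simp add: children_on_def)
    have "(\<forall>w\<in>A - {r}. r < w) \<longleftrightarrow> r = Min A"
    proof
      assume "\<forall>w\<in>A - {r}. r < w"
      then have "r \<le> w" if "w \<in> A" for w using that by (cases "w = r") (auto intro: less_imp_le)
      then show "r = Min A" using fin p by (metis Min_eqI)
    next
      assume "r = Min A"
      then show "\<forall>w\<in>A - {r}. r < w" using fin by (auto simp: order_less_le)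
    qed
    then show "u ^ prop [case p of (r, cs) \<Rightarrow> Node r cs] =
        (case p of (r, cs) \<Rightarrow> (if r = Min A then u else 1) * u ^ prop (map snd cs))"
      by (simp add: p prop_Node V)
  qed simp
  also have "\<dots> = (\<Sum>r\<in>A. \<Sum>cs\<in>children_on k k (A - {r}). (if r = Min A then u else 1) * u ^ prop (map snd cs))"
    using fin children by (intro sum.Sigma[symmetric]) auto
  also have "\<dots> = (\<Sum>r\<in>A. (if r = Min A then u else 1) * Q (card A - 1) (of_nat k * u))"
    unfolding sum_distrib_left[symmetric] using children by (intro sum.cong) auto
  also have "\<dots> = (\<Sum>r\<in>A. (if r = Min A then u else 1)) * Q (card A - 1) (of_nat k * u)"
    by (simp only: sum_distrib_right)
  also have "(\<Sum>r\<in>A. (if r = Min A then u else 1)) = of_nat (card A - 1) + u"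
    using fin ne by (subst sum.remove[of _ "Min A"]) auto
  also have "(of_nat (card A - 1) + u) * Q (card A - 1) (of_nat k * u) = - Q (Suc (card A - 1)) (- u)"
    unfolding P_minus_u by (simp only: mult_minus_left minus_minus)
  also have "Suc (card A - 1) = card A" using fin ne by (simp add: card_gt_0_iff)
  finally show "(\<Sum>t\<in>trees_on k A. u ^ prop [t]) = - Q (card A) (- u)" .
qed

text \<open>Each color multiplies by one more forest, and the convolution takes \<open>j u\<close>
  and \<open>u\<close> to \<open>(j + 1) u\<close>. The forest sums are assumed only up to
  \<open>n\<close> vertices, as this serves inside an induction on that bound.\<close>

lemma sum_children_on:
  assumes forests: "\<And>B. finite B \<Longrightarrow> card B \<le> n \<Longrightarrow>
      finite (forests_on k B) \<and> (\<Sum>F\<in>forests_on k B. u ^ prop F) = Q (card B) u"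
    and "finite A" "card A \<le> n"
  shows "finite (children_on k j A) \<and>
    (\<Sum>cs\<in>children_on k j A. u ^ prop (map snd cs)) = Q (card A) (of_nat j * u)"
  using assms(2,3)
proof (induction j arbitrary: A)
  case 0
  then show ?case by (simp add: children_on_0 P_of_zero)
next
  case (Suc j)
  have sub: "finite B" "card B \<le> n" if "B \<subseteq> A" for B
    using that Suc.prems card_mono[of A B] by (auto intro: finite_subset)
  note product = sum_disjoint_product[OF children_on_Suc \<open>finite A\<close>,
      where w = "\<lambda>cs. u ^ prop (map snd cs)" and wx = "\<lambda>cs. u ^ prop (map snd cs)" and wy = "\<lambda>F. u ^ prop F"]
  have fin: "finite (children_on k j B \<times> forests_on k (A - B))" if "B \<subseteq> A" for B
    using that sub Suc.IH forests by auto
  have w: "u ^ prop (map snd (cs @ map (Pair (Suc j)) F)) = u ^ prop (map snd cs) * u ^ prop F"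
    if "cs \<in> children_on k j B" "F \<in> forests_on k (A - B)" for B cs F
    using that by (simp add: comp_def prop_append children_on_def forests_on_def power_add)
  have "(\<Sum>cs\<in>children_on k (Suc j) A. u ^ prop (map snd cs)) =
      (\<Sum>B\<in>Pow A. (\<Sum>cs\<in>children_on k j B. u ^ prop (map snd cs)) * (\<Sum>F\<in>forests_on k (A - B). u ^ prop F))"
    by (rule product(2)[OF fin w])
  also have "\<dots> = (\<Sum>B\<in>Pow A. Q (card B) (of_nat j * u) * Q (card A - card B) u)"
  proof (rule sum.cong)
    fix B assume "B \<in> Pow A"
    then have B: "B \<subseteq> A" by simp
    have "card (A - B) = card A - card B" by (rule card_Diff_subset[OF sub(1)[OF B] B])
    then show "(\<Sum>cs\<in>children_on k j B. u ^ prop (map snd cs)) * (\<Sum>F\<in>forests_on k (A - B). u ^ prop F) =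
        Q (card B) (of_nat j * u) * Q (card A - card B) u"
      using Suc.IH[OF sub[OF B]] forests[OF sub[of "A - B"]] by simp
  qed simp
  also have "\<dots> = (\<Sum>m\<le>card A. of_nat (card A choose m) * (Q m (of_nat j * u) * Q (card A - m) u))"
    by (rule sum_Pow_card[OF \<open>finite A\<close>])
  also have "\<dots> = Q (card A) (of_nat j * u + u)"
    unfolding P_convolution[symmetric] by (simp only: mult.assoc)
  also have "of_nat j * u + u = of_nat (Suc j) * u" by (simp add: algebra_simps)
  finally have sum: "(\<Sum>cs\<in>children_on k (Suc j) A. u ^ prop (map snd cs)) = Q (card A) (of_nat (Suc j) * u)" .
  have "finite (children_on k (Suc j) A)" by (rule product(1)[OF fin w])
  with sum show ?case by blast
qed

text \<open>Induction on a bound for the number of vertices: removing the root of a tree, or the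
  nonempty first tree of a forest, leaves at most \<open>n\<close> of at most \<open>n + 1\<close>
  vertices.\<close>

lemma sum_forests_on:
  "finite A \<Longrightarrow> card A \<le> n \<Longrightarrow>
    finite (forests_on k A) \<and> (\<Sum>F\<in>forests_on k A. u ^ prop F) = Q (card A) u"
proof (induction n arbitrary: A)
  case 0
  then show ?case by simp
next
  case (Suc n)
  show ?case
  proof (cases "A = {}")
    case False
    have sub: "finite B" "card B \<le> Suc n" if "B \<subseteq> A" for B
      using that Suc.prems card_mono[of A B] by (auto intro: finite_subset)
    have trees: "finite (trees_on k B)" "(\<Sum>t\<in>trees_on k B. u ^ prop [t]) = - Q (card B) (- u)"
      if "B \<subseteq> A" "B \<noteq> {}" for B
    proof -
      have children: "finite (children_on k k (B - {r})) \<and>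
          (\<Sum>cs\<in>children_on k k (B - {r}). u ^ prop (map snd cs)) = Q (card B - 1) (of_nat k * u)"
        if "r \<in> B" for r
        using sum_children_on[of n "B - {r}" k, OF Suc.IH] sub[OF \<open>B \<subseteq> A\<close>] that
        by (simp add: card_Diff_subset)
      show "finite (trees_on k B)"
        by (rule sum_trees_on(1)[OF sub(1)[OF that(1)] that(2) children])
      show "(\<Sum>t\<in>trees_on k B. u ^ prop [t]) = - Q (card B) (- u)"
        by (rule sum_trees_on(2)[OF sub(1)[OF that(1)] that(2) children])
    qed
    have rest: "finite (forests_on k (A - B))"
      "(\<Sum>F\<in>forests_on k (A - B). u ^ prop F) = Q (card A - card B) u" if "B \<subseteq> A" "B \<noteq> {}" for B
    proof -
      have "card B > 0" using that sub card_gt_0_iff by blast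
      moreover have "card (A - B) = card A - card B"
        by (rule card_Diff_subset[OF sub(1)[OF that(1)] that(1)])
      ultimately have "card (A - B) \<le> n" using Suc.prems(2) by linarith
      then show "finite (forests_on k (A - B))"
        "(\<Sum>F\<in>forests_on k (A - B). u ^ prop F) = Q (card A - card B) u"
        using Suc.IH[of "A - B"] that sub Suc.prems by (auto simp: card_Diff_subset)
    qed
    note product = sum_disjoint_product[OF forests_on_Cons[OF False] Suc.prems(1),
      where w = "\<lambda>F. u ^ prop F" and wx = "\<lambda>t. u ^ prop [t]" and wy = "\<lambda>F. u ^ prop F"]
    \<comment> \<open>For empty \<open>B\<close> the product is empty, so the finiteness of
      \<open>forests_on k A\<close>, still to be shown, is not presupposed.\<close>
    have fin: "finite (trees_on k B \<times> forests_on k (A - B))" if "B \<subseteq> A" for B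
      using that trees(1) rest(1) by (cases "B = {}") auto
    have w: "u ^ prop (t # F) = u ^ prop [t] * u ^ prop F"
      if "t \<in> trees_on k B" "F \<in> forests_on k (A - B)" for B t F
    proof -
      have "prop (t # F) = prop [t] + prop F"
        using that by (intro prop_Cons) (auto simp: trees_on_def forests_on_def)
      then show ?thesis by (simp add: power_add)
    qed
    have "(\<Sum>F\<in>forests_on k A. u ^ prop F) =
        (\<Sum>B\<in>Pow A. (\<Sum>t\<in>trees_on k B. u ^ prop [t]) * (\<Sum>F\<in>forests_on k (A - B). u ^ prop F))"
      by (rule product(2)[OF fin w])
    \<comment> \<open>At \<open>B = {}\<close> the bracket is \<open>1 - Q 0 (- u) = 0\<close>,
      matching the absence of empty trees; so all of \<open>Pow A\<close> can enter one
      convolution.\<close>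
    also have "\<dots> = (\<Sum>B\<in>Pow A. ((if card B = 0 then 1 else 0) - Q (card B) (- u)) * Q (card A - card B) u)"
    proof (rule sum.cong)
      fix B assume "B \<in> Pow A"
      then have "B \<subseteq> A" "card B = 0 \<longleftrightarrow> B = {}" using sub by auto
      then show "(\<Sum>t\<in>trees_on k B. u ^ prop [t]) * (\<Sum>F\<in>forests_on k (A - B). u ^ prop F) =
          ((if card B = 0 then 1 else 0) - Q (card B) (- u)) * Q (card A - card B) u"
        using trees(2) rest(2) by (cases "B = {}") auto
    qed simp
    also have "\<dots> = (\<Sum>m\<le>card A. of_nat (card A choose m) *
        (((if m = 0 then 1 else 0) - Q m (- u)) * Q (card A - m) u))"
      by (rule sum_Pow_card[OF Suc.prems(1)])
    also have "\<dots> = (\<Sum>m\<le>card A. if m = 0 then Q (card A) u else 0) -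
        (\<Sum>m\<le>card A. of_nat (card A choose m) * Q m (- u) * Q (card A - m) u)"
      unfolding sum_subtractf[symmetric] by (rule sum.cong) (auto simp: algebra_simps)
    \<comment> \<open>The convolution of \<open>- u\<close> with \<open>u\<close> is
      \<open>Q (card A) 0\<close>, which vanishes as \<open>A\<close> is nonempty; this is
      \<open>(1 - T) F = 1\<close>.\<close>
    also have "\<dots> = Q (card A) u"
      unfolding P_convolution using False Suc.prems(1) by (simp add: P_of_zero)
    finally have sum: "(\<Sum>F\<in>forests_on k A. u ^ prop F) = Q (card A) u" .
    have "finite (forests_on k A)" by (rule product(1)[OF fin w])
    with sum show ?thesis by blast
  qed simp
qed

end

section \<open>Specialization to the vertex set \<open>[n]\<close>\<close>

theorem theorem8p1:
  fixes k :: nat and u :: "'a::comm_ring_1"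
  assumes "k \<ge> 1"
  shows "(\<forall>n. (\<Sum>F\<in>colored_forests k n. u ^ prop F) = P n (of_nat k) (of_nat (k + 1) * u) u) \<and>
         (\<forall>n\<ge>1. (\<Sum>T\<in>colored_trees k n. u ^ prop T) = - P n (of_nat k) (of_nat (k + 1) * u) (- u))"
proof (intro conjI allI impI)
  fix n :: nat
  have "colored_forests k n = forests_on k {1..n}"
    by (simp add: colored_forests_def forests_on_def)
  then show "(\<Sum>F\<in>colored_forests k n. u ^ prop F) = P n (of_nat k) (of_nat (k + 1) * u) u"
    using sum_forests_on[of "{1..n}" n k u] by simp
next
  fix n :: nat assume n: "n \<ge> 1"
  have "colored_trees k n = (\<lambda>t. [t]) ` trees_on k {1..n}"
  proof (intro equalityI subsetI)
    fix F assume F: "F \<in> colored_trees k n"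
    then obtain t where "F = [t]" by (cases F) (auto simp: colored_trees_def)
    with F show "F \<in> (\<lambda>t. [t]) ` trees_on k {1..n}"
      by (simp add: colored_trees_def colored_forests_def trees_on_def)
  next
    fix F assume "F \<in> (\<lambda>t. [t]) ` trees_on k {1..n}"
    then obtain t where "F = [t]" "t \<in> trees_on k {1..n}" by blast
    then show "F \<in> colored_trees k n"
      by (simp add: colored_trees_def colored_forests_def trees_on_def)
  qed
  then have "(\<Sum>T\<in>colored_trees k n. u ^ prop T) = (\<Sum>t\<in>trees_on k {1..n}. u ^ prop [t])"
    by (simp add: sum.reindex inj_on_def)
  also have "\<dots> = - P (card {1..n}) (of_nat k) (of_nat (k + 1) * u) (- u)"
  proof (rule sum_trees_on(2))
    fix r assume "r \<in> {1..n}"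
    then show "finite (children_on k k ({1..n} - {r})) \<and>
        (\<Sum>cs\<in>children_on k k ({1..n} - {r}). u ^ prop (map snd cs)) =
          P (card {1..n} - 1) (of_nat k) (of_nat (k + 1) * u) (of_nat k * u)"
      using sum_children_on[of n k u "{1..n} - {r}" k, OF sum_forests_on] by simp
  qed (use n in auto)
  finally show "(\<Sum>T\<in>colored_trees k n. u ^ prop T) = - P n (of_nat k) (of_nat (k + 1) * u) (- u)"
    by simp
qed

end
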